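(* Let $p_i$ denote the $i$-th prime, let $j$ be a positive integer, and let $f:\mathbb{N}\to\mathbb{N}$ be a function with $f(1)=1$ such that (i) for every $i$ and every prime $p_r$ dividing $f(i)$ we have $r<i$, and (ii) for every $t\in\mathbb{N}$ the equation $f(s)=t$ has only finitely many solutions $s$. Let $H$ be the completely additive function determined by $H(p_i)=H(f(i))+j$ for all $i\ge1$ (well defined by recursion on $i$ thanks to (i)). Then $H$ is a height function.
   Context: $\mathbb{N}$ denotes the positive integers. A function $H:\mathbb{N}\to\mathbb{N}\cup\{0\}$ is completely additive if $H(ab)=H(a)+H(b)$ for all positive integers $a,b$ (so $H(1)=0$). A height function is a completely additive $H:\mathbb{N}\to\mathbb{N}\cup\{0\}$ such that (a) for every integer $n>0$ only finitely many primes $p$ satisfy $H(p)=n$, and (b) $H(p)\neq0$ for every prime $p$. *)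

theory Defs
  imports "HOL-Computational_Algebra.Primes" "HOL-Library.Infinite_Set"
begin

text \<open>
  The positive integers are represented by type \<^typ>\<open>nat\<close> with explicit positivity guards;
  the values of functions at \<open>0\<close> are unconstrained.
\<close>

text \<open>Indexed from \<open>1\<close>, so \<open>ith_prime 1 = 2\<close>; \<open>ith_prime 0\<close> is a junk value.\<close>

definition ith_prime :: "nat \<Rightarrow> nat" where
  "ith_prime i = enumerate {p. prime p} (i - 1)"

definition completely_additive :: "(nat \<Rightarrow> nat) \<Rightarrow> bool" where
  "completely_additive H \<longleftrightarrow> (\<forall>a>0. \<forall>b>0. H (a * b) = H a + H b)"

definition height_function :: "(nat \<Rightarrow> nat) \<Rightarrow> bool" where
  "height_function H \<longleftrightarrow>
     completely_additive H \<and>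
     (\<forall>n>0. finite {p. prime p \<and> H p = n}) \<and>
     (\<forall>p. prime p \<longrightarrow> H p \<noteq> 0)"

definition recursive_additive :: "(nat \<Rightarrow> nat) \<Rightarrow> nat \<Rightarrow> (nat \<Rightarrow> nat) \<Rightarrow> bool" where
  "recursive_additive f j H \<longleftrightarrow>
     completely_additive H \<and> (\<forall>i\<ge>1. H (ith_prime i) = H (f i) + j)"

end

theory Submission
  imports Defs
begin

text \<open>
  Indexing by the primes themselves, the recursion reads \<open>H p = H (e p) + j\<close>, where \<open>e p = f i\<close> for
  the \<open>i\<close>-th prime \<open>p\<close>. Condition (i) says that the prime factors of \<open>e p\<close> are smaller than \<open>p\<close>, so
  \<open>H\<close> is determined on the primes by well-founded recursion, and everywhere by additivity.

  For the finiteness, suppose that only finitely many primes have height at most \<open>k\<close>. An integer of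
  height at most \<open>k\<close> is a product of at most \<open>k\<close> of them, since each has height at least \<open>1\<close>; so these
  integers are finite in number as well. A prime \<open>p\<close> of height at most \<open>k + 1\<close> has \<open>H (e p) \<le> k\<close>, so it
  lies in one of finitely many fibres of \<open>e\<close>, and these are finite by condition (ii).
\<close>

lemma completely_additive_mult:
  "completely_additive H \<Longrightarrow> a > 0 \<Longrightarrow> b > 0 \<Longrightarrow> H (a * b) = H a + H b"
  by (simp add: completely_additive_def)

lemma completely_additive_one: "completely_additive H \<Longrightarrow> H 1 = 0"
  using completely_additive_mult[of H 1 1] by simp

lemma completely_additive_prod_mset:
  assumes "completely_additive H" and "0 \<notin># A"
  shows "H (\<Prod>\<^sub># A) = (\<Sum>a\<in>#A. H a)"
  using assms(2)
proof (induction A)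
  case empty
  show ?case using completely_additive_one[OF assms(1)] by simp
next
  case (add a A)
  then have "a > 0" and "\<Prod>\<^sub># A > 0" by (auto intro: Nat.gr0I)
  with add show ?case by (simp add: completely_additive_mult[OF assms(1)])
qed

lemma completely_additive_eq_sum_prime_factorization:
  assumes "completely_additive H" and "n > 0"
  shows "H n = (\<Sum>p\<in>#prime_factorization n. H p)"
proof -
  have "0 \<notin># prime_factorization n" by (auto dest: in_prime_factors_imp_prime)
  from completely_additive_prod_mset[OF assms(1) this] show ?thesis
    using \<open>n > 0\<close> by (simp add: prod_mset_prime_factorization_nat)
qed

lemma completely_additive_eqI:
  assumes "completely_additive H" and "completely_additive H'" and "n > 0"
    and "\<And>p. p \<in> prime_factors n \<Longrightarrow> H p = H' p"
  shows "H n = H' n"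
proof -
  have "H n = (\<Sum>p\<in>#prime_factorization n. H p)"
    using assms(1,3) by (rule completely_additive_eq_sum_prime_factorization)
  also have "\<dots> = (\<Sum>p\<in>#prime_factorization n. H' p)"
    using assms(4) by (simp cong: image_mset_cong)
  also have "\<dots> = H' n"
    using assms(2,3) by (rule completely_additive_eq_sum_prime_factorization[symmetric])
  finally show ?thesis .
qed

definition additive_extension :: "(nat \<Rightarrow> nat) \<Rightarrow> nat \<Rightarrow> nat" where
  "additive_extension g n = (\<Sum>p\<in>#prime_factorization n. g p)"

lemma completely_additive_additive_extension: "completely_additive (additive_extension g)"
  by (simp add: completely_additive_def additive_extension_def prime_factorization_mult)

lemma additive_extension_prime: "prime p \<Longrightarrow> additive_extension g p = g p"
  by (simp add: additive_extension_def prime_factorization_prime)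

lemma completely_additive_finite_le:
  assumes "completely_additive H" and "\<And>p. prime p \<Longrightarrow> H p \<noteq> 0"
    and "finite {p. prime p \<and> H p \<le> m}"
  shows "finite {n. n > 0 \<and> H n \<le> m}"
proof (rule finite_subset)
  let ?P = "{p. prime p \<and> H p \<le> m}"
  show "finite (prod_mset ` (\<Union>k\<in>{..m}. multisets_of_size ?P k))"
    using assms(3) by (intro finite_imageI finite_UN_I finite_multisets_of_size finite_atMost)
  show "{n. n > 0 \<and> H n \<le> m} \<subseteq> prod_mset ` (\<Union>k\<in>{..m}. multisets_of_size ?P k)"
  proof clarify
    fix n assume "n > 0" and "H n \<le> m"
    let ?F = "prime_factorization n"
    have sum_le: "(\<Sum>p\<in>#?F. H p) \<le> m"
      using completely_additive_eq_sum_prime_factorization[OF assms(1) \<open>n > 0\<close>] \<open>H n \<le> m\<close>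
      by simp
    have "size ?F = (\<Sum>p\<in>#?F. 1)" by (rule size_eq_sum_mset)
    also have "\<dots> \<le> (\<Sum>p\<in>#?F. H p)"
      using assms(2) by (intro sum_mset_mono) (auto simp: Suc_le_eq dest: in_prime_factors_imp_prime)
    finally have "size ?F \<le> m" using sum_le by simp
    moreover have "H p \<le> m" if "p \<in># ?F" for p
      using multi_member_split[OF that] sum_le by auto
    then have "set_mset ?F \<subseteq> ?P" by (auto dest: in_prime_factors_imp_prime)
    ultimately have "?F \<in> (\<Union>k\<in>{..m}. multisets_of_size ?P k)"
      by (simp add: multisets_of_size_def)
    moreover have "n = \<Prod>\<^sub># ?F"
      using \<open>n > 0\<close> by (rule prod_mset_prime_factorization_nat[symmetric])
    ultimately show "n \<in> prod_mset ` (\<Union>k\<in>{..m}. multisets_of_size ?P k)"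
      by (rule rev_image_eqI)
  qed
qed

definition prime_recursive :: "(nat \<Rightarrow> nat) \<Rightarrow> (nat \<Rightarrow> nat) \<Rightarrow> (nat \<Rightarrow> nat) \<Rightarrow> bool" where
  "prime_recursive e c H \<longleftrightarrow> completely_additive H \<and> (\<forall>p. prime p \<longrightarrow> H p = H (e p) + c p)"

lemma prime_recursive_completely_additive: "prime_recursive e c H \<Longrightarrow> completely_additive H"
  by (simp add: prime_recursive_def)

lemma prime_recursive_prime: "prime_recursive e c H \<Longrightarrow> prime p \<Longrightarrow> H p = H (e p) + c p"
  by (simp add: prime_recursive_def)

lemma prime_recursive_prime_nonzero:
  "prime_recursive e c H \<Longrightarrow> prime p \<Longrightarrow> c p > 0 \<Longrightarrow> H p \<noteq> 0"
  by (simp add: prime_recursive_prime)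

text \<open>
  The filter makes the recursion terminate for arbitrary \<open>e\<close>; it is vacuous when all prime factors
  of \<open>e p\<close> are smaller than \<open>p\<close>.
\<close>
fun prime_height :: "(nat \<Rightarrow> nat) \<Rightarrow> (nat \<Rightarrow> nat) \<Rightarrow> nat \<Rightarrow> nat" where
  "prime_height e c p =
     (\<Sum>q\<in>#filter_mset (\<lambda>q. q < p) (prime_factorization (e p)). prime_height e c q) + c p"

declare prime_height.simps [simp del]

lemma prime_recursive_additive_extension_prime_height:
  assumes "\<And>p q. prime p \<Longrightarrow> q \<in> prime_factors (e p) \<Longrightarrow> q < p"
  shows "prime_recursive e c (additive_extension (prime_height e c))"
  unfolding prime_recursive_def
proof (intro conjI allI impI)
  fix p :: nat assume "prime p"
  then have "filter_mset (\<lambda>q. q < p) (prime_factorization (e p)) = prime_factorization (e p)"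
    using assms by (simp add: filter_mset_eq_conv)
  then have "prime_height e c p = additive_extension (prime_height e c) (e p) + c p"
    by (simp add: prime_height.simps[of e c p] additive_extension_def)
  then show "additive_extension (prime_height e c) p
      = additive_extension (prime_height e c) (e p) + c p"
    by (simp add: additive_extension_prime[OF \<open>prime p\<close>])
qed (rule completely_additive_additive_extension)

lemma prime_recursive_unique:
  assumes "\<And>p. prime p \<Longrightarrow> e p > 0"
    and "\<And>p q. prime p \<Longrightarrow> q \<in> prime_factors (e p) \<Longrightarrow> q < p"
    and H: "prime_recursive e c H" and H': "prime_recursive e c H'" and "n > 0"
  shows "H n = H' n"
proof -
  note eqI = completely_additive_eqI[OF H[THEN prime_recursive_completely_additive]
      H'[THEN prime_recursive_completely_additive]]
  have "H p = H' p" if "prime p" for p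
    using that
  proof (induction p rule: less_induct)
    case (less p)
    have "H (e p) = H' (e p)"
    proof (rule eqI)
      show "e p > 0" using less.prems by (rule assms(1))
      show "H q = H' q" if "q \<in> prime_factors (e p)" for q
        using assms(2)[OF less.prems that] in_prime_factors_imp_prime[OF that] by (rule less.IH)
    qed
    then show ?case
      using less.prems by (simp add: prime_recursive_prime[OF H] prime_recursive_prime[OF H'])
  qed
  then show ?thesis using \<open>n > 0\<close> by (auto intro: eqI dest: in_prime_factors_imp_prime)
qed

lemma prime_recursive_finite_primes_le:
  assumes H: "prime_recursive e c H"
    and e_pos: "\<And>p. prime p \<Longrightarrow> e p > 0" and c_pos: "\<And>p. prime p \<Longrightarrow> c p > 0"
    and fibres: "\<And>t. t > 0 \<Longrightarrow> finite {p. prime p \<and> e p = t}"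
  shows "finite {p. prime p \<and> H p \<le> m}"
proof (induction m)
  case 0
  have "H p \<noteq> 0" if "prime p" for p
    using H that c_pos[OF that] by (rule prime_recursive_prime_nonzero)
  then have "{p. prime p \<and> H p \<le> 0} = {}" by simp
  then show ?case by (simp only: finite.emptyI)
next
  case (Suc m)
  let ?A = "{n. n > 0 \<and> H n \<le> m}"
  have "finite ?A"
    using prime_recursive_completely_additive[OF H] prime_recursive_prime_nonzero[OF H _ c_pos] Suc.IH
    by (rule completely_additive_finite_le)
  moreover have "finite (e -` {t} \<inter> {p. prime p})" if "t \<in> ?A" for t
    using fibres[of t] that by (simp add: vimage_def Int_def conj_commute)
  ultimately have "finite (e -` ?A \<inter> {p. prime p})" by (rule finite_finite_vimage_IntI)
  moreover have "e p \<in> ?A" if "prime p" and "H p \<le> Suc m" for p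
    using that prime_recursive_prime[OF H \<open>prime p\<close>] e_pos[OF \<open>prime p\<close>] c_pos[OF \<open>prime p\<close>]
    by simp
  then have "{p. prime p \<and> H p \<le> Suc m} \<subseteq> e -` ?A \<inter> {p. prime p}" by auto
  ultimately show ?case by (rule rev_finite_subset)
qed

lemma prime_recursive_height_function:
  assumes H: "prime_recursive e c H"
    and "\<And>p. prime p \<Longrightarrow> e p > 0" and c_pos: "\<And>p. prime p \<Longrightarrow> c p > 0"
    and "\<And>t. t > 0 \<Longrightarrow> finite {p. prime p \<and> e p = t}"
  shows "height_function H"
  unfolding height_function_def
proof (intro conjI allI impI)
  show "completely_additive H" using H by (rule prime_recursive_completely_additive)
  show "finite {p. prime p \<and> H p = n}" for n
    using prime_recursive_finite_primes_le[OF assms, of n] by (rule rev_finite_subset) auto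
  show "H p \<noteq> 0" if "prime p" for p
    using H that c_pos[OF that] by (rule prime_recursive_prime_nonzero)
qed

lemma bij_betw_ith_prime: "bij_betw ith_prime {1..} {p. prime p}"
proof -
  have "bij_betw (\<lambda>i. i - 1) {1..} (UNIV :: nat set)"
    by (rule bij_betw_byWitness[where f' = Suc]) auto
  from bij_betw_trans[OF this bij_enumerate[OF primes_infinite]] show ?thesis
    by (simp add: ith_prime_def comp_def cong: bij_betw_cong)
qed

lemma ith_prime_less_iff: "i \<ge> 1 \<Longrightarrow> r \<ge> 1 \<Longrightarrow> ith_prime i < ith_prime r \<longleftrightarrow> i < r"
  by (auto simp: ith_prime_def primes_infinite)

definition prime_index :: "nat \<Rightarrow> nat" where
  "prime_index = inv_into {1..} ith_prime"

lemma prime_index_ge_1: "prime p \<Longrightarrow> prime_index p \<ge> 1"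
  using bij_betw_apply[OF bij_betw_inv_into[OF bij_betw_ith_prime]] by (simp add: prime_index_def)

lemma ith_prime_prime_index: "prime p \<Longrightarrow> ith_prime (prime_index p) = p"
  using bij_betw_inv_into_right[OF bij_betw_ith_prime] by (simp add: prime_index_def)

lemma prime_index_ith_prime: "i \<ge> 1 \<Longrightarrow> prime_index (ith_prime i) = i"
  using bij_betw_inv_into_left[OF bij_betw_ith_prime] by (simp add: prime_index_def)

lemma prime_ith_prime: "i \<ge> 1 \<Longrightarrow> prime (ith_prime i)"
  using bij_betw_apply[OF bij_betw_ith_prime] by simp

lemma recursive_additive_iff_prime_recursive:
  "recursive_additive f j H \<longleftrightarrow> prime_recursive (\<lambda>p. f (prime_index p)) (\<lambda>_. j) H"
proof -
  have "(\<forall>i\<ge>1. H (ith_prime i) = H (f i) + j)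
      \<longleftrightarrow> (\<forall>p. prime p \<longrightarrow> H p = H (f (prime_index p)) + j)"
    by (metis prime_index_ge_1 ith_prime_prime_index prime_index_ith_prime prime_ith_prime)
  then show ?thesis by (simp add: recursive_additive_def prime_recursive_def)
qed

lemma prime_factor_at_prime_index_less:
  assumes "\<And>i r. i \<ge> 1 \<Longrightarrow> r \<ge> 1 \<Longrightarrow> ith_prime r dvd f i \<Longrightarrow> r < i"
    and "prime p" and "q \<in> prime_factors (f (prime_index p))"
  shows "q < p"
proof -
  have "prime q" and "q dvd f (prime_index p)" using assms(3) by auto
  with \<open>prime p\<close> have "prime_index q < prime_index p"
    by (intro assms(1)) (simp_all only: prime_index_ge_1 ith_prime_prime_index)
  then have "ith_prime (prime_index q) < ith_prime (prime_index p)"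
    using \<open>prime p\<close> \<open>prime q\<close> by (simp only: ith_prime_less_iff prime_index_ge_1)
  then show ?thesis
    using \<open>prime p\<close> \<open>prime q\<close> by (simp only: ith_prime_prime_index)
qed

lemma finite_prime_index_fibre:
  assumes "finite {s. s \<ge> 1 \<and> f s = t}"
  shows "finite {p. prime p \<and> f (prime_index p) = t}"
proof (rule finite_subset)
  show "{p. prime p \<and> f (prime_index p) = t} \<subseteq> ith_prime ` {s. s \<ge> 1 \<and> f s = t}"
  proof
    fix p assume p: "p \<in> {p. prime p \<and> f (prime_index p) = t}"
    then have "p = ith_prime (prime_index p)" by (simp add: ith_prime_prime_index)
    moreover have "prime_index p \<in> {s. s \<ge> 1 \<and> f s = t}"
      using p prime_index_ge_1[of p] by simp
    ultimately show "p \<in> ith_prime ` {s. s \<ge> 1 \<and> f s = t}" by (rule image_eqI)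
  qed
qed (use assms in simp)

theorem theorem3p1:
  fixes f :: "nat \<Rightarrow> nat" and j :: nat
  assumes j_pos: "j > 0"
    and f_pos: "\<And>i. i \<ge> 1 \<Longrightarrow> f i \<ge> 1"
    and f_1: "f 1 = 1"
    and f_primes: "\<And>i r. i \<ge> 1 \<Longrightarrow> r \<ge> 1 \<Longrightarrow> ith_prime r dvd f i \<Longrightarrow> r < i"
    and f_fibres: "\<And>t. t \<ge> 1 \<Longrightarrow> finite {s. s \<ge> 1 \<and> f s = t}"
  shows "(\<exists>H. recursive_additive f j H) \<and>
         (\<forall>H H'. recursive_additive f j H \<longrightarrow> recursive_additive f j H' \<longrightarrow>
            (\<forall>n\<ge>1. H n = H' n)) \<and>
         (\<forall>H. recursive_additive f j H \<longrightarrow> height_function H)"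
proof -
  let ?e = "\<lambda>p. f (prime_index p)" and ?c = "\<lambda>_ :: nat. j"
  have e_pos: "?e p > 0" if "prime p" for p
    using f_pos[OF prime_index_ge_1[OF that]] by simp
  have e_less: "q < p" if "prime p" and "q \<in> prime_factors (?e p)" for p q
    using f_primes that by (rule prime_factor_at_prime_index_less)
  have e_fibres: "finite {p. prime p \<and> ?e p = t}" if "t > 0" for t
    using that by (intro finite_prime_index_fibre f_fibres) simp
  have "prime_recursive ?e ?c (additive_extension (prime_height ?e ?c))"
    using e_less by (rule prime_recursive_additive_extension_prime_height)
  moreover have "H n = H' n"
    if "prime_recursive ?e ?c H" and "prime_recursive ?e ?c H'" and "n \<ge> 1" for H H' n
    by (rule prime_recursive_unique[OF e_pos e_less that(1,2)]) (use that(3) in simp_all)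
  moreover have "height_function H" if "prime_recursive ?e ?c H" for H
    using that e_pos j_pos e_fibres by (rule prime_recursive_height_function)
  ultimately show ?thesis unfolding recursive_additive_iff_prime_recursive by blast
qed

end
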